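(* Suppose that $E$ is a directed graph and $K$ is a field. Then every $a\in L_K(E)_0$ belongs to a finite-dimensional $*$-subalgebra of $L_K(E)_0$.
   Context: A directed graph $E=(E^0,E^1,r,s)$ consists of sets $E^0$ (vertices), $E^1$ (edges) and maps $r,s:E^1\to E^0$ (range and source). Raeburn's path convention is used: a finite path of length $n\geq 1$ is a word $\alpha=\alpha_1\alpha_2\cdots\alpha_n$ of edges with $s(\alpha_i)=r(\alpha_{i+1})$ for $1\le i<n$; $|\alpha|=n$, $r(\alpha)=r(\alpha_1)$, $s(\alpha)=s(\alpha_n)$. Vertices are paths of length $0$ with $r(v)=s(v)=v$. $E^*$ is the set of all finite paths. The Leavitt path algebra $L_K(E)$ is the universal $K$-algebra generated by $\{v:v\in E^0\}\cup\{e,e^*:e\in E^1\}$ subject to $vw=\delta_{v,w}v$; $r(e)e=e=e\,s(e)$; $s(e)e^*=e^*=e^*r(e)$; $e^*f=\delta_{e,f}s(e)$; and $v=\sum_{r(e)=v}ee^*$ whenever $0<|r^{-1}(v)|<\infty$. With $\alpha^*:=\alpha_n^*\cdots\alpha_1^*$ for $\alpha=\alpha_1\cdots\alpha_n$ and $v^*:=v$, it is spanned by the elements $\alpha\beta^*$ with $\alpha,\beta\in E^*$, $s(\alpha)=s(\beta)$. It is $\mathbb{Z}$-graded, and its core (degree-zero component) is $L_K(E)_0:=\operatorname{span}\{\alpha\beta^*:s(\alpha)=s(\beta),|\alpha|=|\beta|\}$. A $*$-subalgebra is a $K$-subalgebra closed under the involution $(c\,\alpha\beta^* )^*=\bar{c}\,\beta\alpha^*$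 ($c\in K$), where $c\mapsto\bar c$ is a fixed involution of $K$ (the identity, or complex conjugation if $K=\mathbb{C}$). *)

theory Defs
  imports "Graph_Theory.Digraph" "HOL-Library.Poly_Mapping"
begin

section \<open>Algebras with involution on a carrier set\<close>

text \<open>
  Algebras over a field \<open>'k\<close>, not necessarily unital, together with an involution.
  The record only collects the operations.
\<close>

record ('k, 'a) star_algebra =
  space :: "'a set"
  azero :: "'a"
  aadd :: "'a \<Rightarrow> 'a \<Rightarrow> 'a"
  amult :: "'a \<Rightarrow> 'a \<Rightarrow> 'a"
  ascale :: "'k \<Rightarrow> 'a \<Rightarrow> 'a"
  astar :: "'a \<Rightarrow> 'a"

inductive_set aspan :: "('k, 'a) star_algebra \<Rightarrow> 'a set \<Rightarrow> 'a set"
  for A :: "('k, 'a) star_algebra" and S :: "'a set" where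
  zero: "azero A \<in> aspan A S"
| base: "x \<in> S \<Longrightarrow> x \<in> aspan A S"
| add: "x \<in> aspan A S \<Longrightarrow> y \<in> aspan A S \<Longrightarrow> aadd A x y \<in> aspan A S"
| scale: "x \<in> aspan A S \<Longrightarrow> ascale A c x \<in> aspan A S"

definition star_subalgebra :: "('k, 'a) star_algebra \<Rightarrow> 'a set \<Rightarrow> bool" where
  "star_subalgebra A B \<longleftrightarrow> B \<subseteq> space A \<and> azero A \<in> B \<and>
     (\<forall>x\<in>B. \<forall>y\<in>B. aadd A x y \<in> B) \<and>
     (\<forall>c. \<forall>x\<in>B. ascale A c x \<in> B) \<and>
     (\<forall>x\<in>B. \<forall>y\<in>B. amult A x y \<in> B) \<and>
     (\<forall>x\<in>B. astar A x \<in> B)"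

definition finite_dimensional :: "('k, 'a) star_algebra \<Rightarrow> 'a set \<Rightarrow> bool" where
  "finite_dimensional A V \<longleftrightarrow> (\<exists>S. finite S \<and> S \<subseteq> V \<and> V = aspan A S)"

definition field_involution :: "('k::field \<Rightarrow> 'k) \<Rightarrow> bool" where
  "field_involution cj \<longleftrightarrow> cj 1 = 1 \<and> (\<forall>x y. cj (x + y) = cj x + cj y) \<and>
     (\<forall>x y. cj (x * y) = cj x * cj y) \<and> (\<forall>x. cj (cj x) = x)"


section \<open>The free algebra on the vertices, edges and ghost edges\<close>

text \<open>
  The copy \<open>gword\<close> of the list type carries concatenation as a (noncommutative) addition,
  so that the convolution product on \<^typ>\<open>'a \<Rightarrow>\<^sub>0 'k\<close> becomes the product of
  noncommutative polynomials.
\<close>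

datatype 'a gword = GWord (letters: "'a list")

instantiation gword :: (type) monoid_add
begin

definition zero_gword :: "'a gword" where
  "0 = GWord []"

definition plus_gword :: "'a gword \<Rightarrow> 'a gword \<Rightarrow> 'a gword" where
  "u + w = GWord (letters u @ letters w)"

instance
  by standard (auto simp: zero_gword_def plus_gword_def)

end

datatype ('v, 'e) gen = Vtx 'v | Edge 'e | Ghost 'e

type_synonym ('v, 'e, 'k) free_alg = "('v, 'e) gen gword \<Rightarrow>\<^sub>0 'k"

abbreviation mon :: "('v, 'e) gen list \<Rightarrow> ('v, 'e, 'k::field) free_alg" where
  "mon xs \<equiv> Poly_Mapping.single (GWord xs) 1"

definition fscale :: "'k::field \<Rightarrow> ('v, 'e, 'k) free_alg \<Rightarrow> ('v, 'e, 'k) free_alg" where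
  "fscale c x = Poly_Mapping.single 0 c * x"

definition gens :: "('v, 'e) pre_digraph \<Rightarrow> ('v, 'e) gen set" where
  "gens G = Vtx ` verts G \<union> Edge ` arcs G \<union> Ghost ` arcs G"

text \<open>
  The empty word is excluded: the free algebra is taken without unit, since the Leavitt path
  algebra has no unit when there are infinitely many vertices.
\<close>

definition free_carrier :: "('v, 'e) pre_digraph \<Rightarrow> ('v, 'e, 'k::field) free_alg set" where
  "free_carrier G = {x. \<forall>w \<in> Poly_Mapping.keys x. letters w \<noteq> [] \<and> set (letters w) \<subseteq> gens G}"

fun gen_star :: "('v, 'e) gen \<Rightarrow> ('v, 'e) gen" where
  "gen_star (Vtx v) = Vtx v"
| "gen_star (Edge e) = Ghost e"
| "gen_star (Ghost e) = Edge e"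

definition word_star :: "('v, 'e) gen gword \<Rightarrow> ('v, 'e) gen gword" where
  "word_star w = GWord (rev (map gen_star (letters w)))"

definition free_star ::
  "('k::field \<Rightarrow> 'k) \<Rightarrow> ('v, 'e, 'k) free_alg \<Rightarrow> ('v, 'e, 'k) free_alg" where
  "free_star cj x =
     (\<Sum>w\<in>Poly_Mapping.keys x. Poly_Mapping.single (word_star w) (cj (Poly_Mapping.lookup x w)))"


section \<open>The Leavitt path algebra\<close>

text \<open>
  Raeburn's convention: the range of an edge is its \<^const>\<open>head\<close>, its source is its \<^const>\<open>tail\<close>,
  and the set of edges with range \<open>v\<close> is \<^term>\<open>in_arcs G v\<close>.
\<close>

inductive_set relators :: "('v, 'e) pre_digraph \<Rightarrow> ('v, 'e, 'k::field) free_alg set"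
  for G :: "('v, 'e) pre_digraph" where
  vertices: "v \<in> verts G \<Longrightarrow> w \<in> verts G \<Longrightarrow>
      mon [Vtx v, Vtx w] - (if v = w then mon [Vtx v] else 0) \<in> relators G"
| range_edge: "e \<in> arcs G \<Longrightarrow> mon [Vtx (head G e), Edge e] - mon [Edge e] \<in> relators G"
| edge_source: "e \<in> arcs G \<Longrightarrow> mon [Edge e, Vtx (tail G e)] - mon [Edge e] \<in> relators G"
| source_ghost: "e \<in> arcs G \<Longrightarrow> mon [Vtx (tail G e), Ghost e] - mon [Ghost e] \<in> relators G"
| ghost_range: "e \<in> arcs G \<Longrightarrow> mon [Ghost e, Vtx (head G e)] - mon [Ghost e] \<in> relators G"
| CK1: "e \<in> arcs G \<Longrightarrow> f \<in> arcs G \<Longrightarrow>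
      mon [Ghost e, Edge f] - (if e = f then mon [Vtx (tail G e)] else 0) \<in> relators G"
| CK2: "v \<in> verts G \<Longrightarrow> finite (in_arcs G v) \<Longrightarrow> in_arcs G v \<noteq> {} \<Longrightarrow>
      mon [Vtx v] - (\<Sum>e\<in>in_arcs G v. mon [Edge e, Ghost e]) \<in> relators G"

inductive_set lpa_ideal :: "('v, 'e) pre_digraph \<Rightarrow> ('v, 'e, 'k::field) free_alg set"
  for G :: "('v, 'e) pre_digraph" where
  rel: "x \<in> relators G \<Longrightarrow> x \<in> lpa_ideal G"
| zero: "0 \<in> lpa_ideal G"
| add: "x \<in> lpa_ideal G \<Longrightarrow> y \<in> lpa_ideal G \<Longrightarrow> x + y \<in> lpa_ideal G"
| scale: "x \<in> lpa_ideal G \<Longrightarrow> fscale c x \<in> lpa_ideal G"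
| mult_left: "x \<in> lpa_ideal G \<Longrightarrow> f \<in> free_carrier G \<Longrightarrow> f * x \<in> lpa_ideal G"
| mult_right: "x \<in> lpa_ideal G \<Longrightarrow> f \<in> free_carrier G \<Longrightarrow> x * f \<in> lpa_ideal G"

definition lpa_class ::
  "('v, 'e) pre_digraph \<Rightarrow> ('v, 'e, 'k::field) free_alg \<Rightarrow> ('v, 'e, 'k) free_alg set" where
  "lpa_class G x = {y \<in> free_carrier G. x - y \<in> lpa_ideal G}"

text \<open>
  The unions below are over all representatives; by the lemmas \<open>LPA_add\<close>, \<open>LPA_mult\<close>,
  \<open>LPA_scale\<close> and \<open>LPA_star\<close> they do not depend on the representative.
\<close>

definition LPA ::
  "('k::field \<Rightarrow> 'k) \<Rightarrow> ('v, 'e) pre_digraph \<Rightarrow> ('k, ('v, 'e, 'k) free_alg set) star_algebra" where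
  "LPA cj G = \<lparr>
     space = lpa_class G ` free_carrier G,
     azero = lpa_class G 0,
     aadd = (\<lambda>X Y. \<Union>x\<in>X. \<Union>y\<in>Y. lpa_class G (x + y)),
     amult = (\<lambda>X Y. \<Union>x\<in>X. \<Union>y\<in>Y. lpa_class G (x * y)),
     ascale = (\<lambda>c X. \<Union>x\<in>X. lpa_class G (fscale c x)),
     astar = (\<lambda>X. \<Union>x\<in>X. lpa_class G (free_star cj x)) \<rparr>"


section \<open>Paths and the core\<close>

datatype ('v, 'e) path = VPath 'v | EPath "'e list"

definition paths :: "('v, 'e) pre_digraph \<Rightarrow> ('v, 'e) path set" where
  "paths G = VPath ` verts G \<union>
     EPath ` {es. es \<noteq> [] \<and> set es \<subseteq> arcs G \<and>
       (\<forall>i. Suc i < length es \<longrightarrow> tail G (es ! i) = head G (es ! Suc i))}"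

fun path_length :: "('v, 'e) path \<Rightarrow> nat" where
  "path_length (VPath v) = 0"
| "path_length (EPath es) = length es"

fun path_source :: "('v, 'e) pre_digraph \<Rightarrow> ('v, 'e) path \<Rightarrow> 'v" where
  "path_source G (VPath v) = v"
| "path_source G (EPath es) = tail G (last es)"

fun path_word :: "('v, 'e) path \<Rightarrow> ('v, 'e) gen list" where
  "path_word (VPath v) = [Vtx v]"
| "path_word (EPath es) = map Edge es"

fun ghost_word :: "('v, 'e) path \<Rightarrow> ('v, 'e) gen list" where
  "ghost_word (VPath v) = [Vtx v]"
| "ghost_word (EPath es) = rev (map Ghost es)"

definition path_product ::
  "('k::field \<Rightarrow> 'k) \<Rightarrow> ('v, 'e) pre_digraph \<Rightarrow> ('v, 'e) path \<Rightarrow> ('v, 'e) path \<Rightarrow>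
     ('v, 'e, 'k) free_alg set" where
  "path_product cj G \<alpha> \<beta> =
     amult (LPA cj G) (lpa_class G (mon (path_word \<alpha>))) (lpa_class G (mon (ghost_word \<beta>)))"

definition LPA_core ::
  "('k::field \<Rightarrow> 'k) \<Rightarrow> ('v, 'e) pre_digraph \<Rightarrow> ('v, 'e, 'k) free_alg set set" where
  "LPA_core cj G = aspan (LPA cj G)
     {path_product cj G \<alpha> \<beta> | \<alpha> \<beta>. \<alpha> \<in> paths G \<and> \<beta> \<in> paths G \<and>
        path_source G \<alpha> = path_source G \<beta> \<and> path_length \<alpha> = path_length \<beta>}"


section \<open>The operations are well defined on classes\<close>

lemma free_carrier_0: "0 \<in> free_carrier G"
  by (simp add: free_carrier_def)

lemma free_carrier_add:
  "x \<in> free_carrier G \<Longrightarrow> y \<in> free_carrier G \<Longrightarrow> x + y \<in> free_carrier G"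
  unfolding free_carrier_def using Poly_Mapping.keys_add[of x y] by blast

lemma free_carrier_mult:
  assumes "x \<in> free_carrier G" "y \<in> free_carrier G"
  shows "x * y \<in> free_carrier G"
proof -
  have "letters w \<noteq> [] \<and> set (letters w) \<subseteq> gens G" if w: "w \<in> Poly_Mapping.keys (x * y)" for w
  proof -
    obtain a b where ab: "w = a + b" "a \<in> Poly_Mapping.keys x" "b \<in> Poly_Mapping.keys y"
      using w Poly_Mapping.keys_mult[of x y] by blast
    then show ?thesis
      using assms unfolding free_carrier_def plus_gword_def by auto
  qed
  then show ?thesis unfolding free_carrier_def by blast
qed

lemma free_carrier_scale:
  assumes "x \<in> free_carrier G" shows "fscale c x \<in> free_carrier G"
proof -
  have "w \<in> Poly_Mapping.keys x" if w: "w \<in> Poly_Mapping.keys (fscale c x)" for w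
  proof -
    obtain a b where ab: "w = a + b" "a \<in> Poly_Mapping.keys (Poly_Mapping.single 0 c)"
      "b \<in> Poly_Mapping.keys x"
      using w Poly_Mapping.keys_mult[of "Poly_Mapping.single 0 c" x] unfolding fscale_def by blast
    then show ?thesis by (auto split: if_splits)
  qed
  then show ?thesis using assms unfolding free_carrier_def by blast
qed

lemma fscale_diff: "fscale c (x - y) = fscale c x - fscale c y"
  by (simp add: fscale_def right_diff_distrib)

lemma fscale_uminus_one: "fscale (- 1) x = - x"
  by (simp add: fscale_def single_uminus)

lemma ideal_uminus: "x \<in> lpa_ideal G \<Longrightarrow> - x \<in> lpa_ideal G"
  using lpa_ideal.scale[of x G "- 1"] by (simp add: fscale_uminus_one)

lemma ideal_diff: "x \<in> lpa_ideal G \<Longrightarrow> y \<in> lpa_ideal G \<Longrightarrow> x - y \<in> lpa_ideal G"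
  using lpa_ideal.add[of x G "- y"] ideal_uminus[of y G] by simp

lemma lpa_class_cong:
  assumes "x - y \<in> lpa_ideal G" shows "lpa_class G x = lpa_class G y"
proof -
  have "x - z \<in> lpa_ideal G \<longleftrightarrow> y - z \<in> lpa_ideal G" for z
    using lpa_ideal.add[of "x - y" G "y - z"] ideal_diff[of "x - z" G "x - y"] assms by auto
  then show ?thesis by (simp add: lpa_class_def)
qed

lemma lpa_class_self: "x \<in> free_carrier G \<Longrightarrow> x \<in> lpa_class G x"
  by (simp add: lpa_class_def lpa_ideal.zero)

lemma lpa_class_eq_iff:
  assumes "y \<in> free_carrier G"
  shows "lpa_class G x = lpa_class G y \<longleftrightarrow> x - y \<in> lpa_ideal G"
proof
  assume "lpa_class G x = lpa_class G y"
  then have "y \<in> lpa_class G x" using lpa_class_self[OF assms] by blast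
  then show "x - y \<in> lpa_ideal G" by (simp add: lpa_class_def)
qed (rule lpa_class_cong)

lemma UN_const: "a \<in> X \<Longrightarrow> (\<And>x. x \<in> X \<Longrightarrow> f x = C) \<Longrightarrow> (\<Union>x\<in>X. f x) = C"
  by blast

lemma UN2_const:
  "a \<in> X \<Longrightarrow> b \<in> Y \<Longrightarrow> (\<And>x y. x \<in> X \<Longrightarrow> y \<in> Y \<Longrightarrow> f x y = C) \<Longrightarrow>
     (\<Union>x\<in>X. \<Union>y\<in>Y. f x y) = C"
  by blast

lemma LPA_add:
  assumes "x \<in> free_carrier G" "y \<in> free_carrier G"
  shows "aadd (LPA cj G) (lpa_class G x) (lpa_class G y) = lpa_class G (x + y)"
proof -
  have "lpa_class G (a + b) = lpa_class G (x + y)"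
    if "a \<in> lpa_class G x" "b \<in> lpa_class G y" for a b
  proof -
    have "(x - a) + (y - b) \<in> lpa_ideal G"
      using that by (auto simp: lpa_class_def intro: lpa_ideal.add)
    then have "(x + y) - (a + b) \<in> lpa_ideal G" by (simp add: algebra_simps)
    then show ?thesis by (rule lpa_class_cong[symmetric])
  qed
  then show ?thesis
    unfolding LPA_def star_algebra.simps
    by (rule UN2_const[OF lpa_class_self[OF assms(1)] lpa_class_self[OF assms(2)]])
qed

lemma LPA_mult:
  assumes "x \<in> free_carrier G" "y \<in> free_carrier G"
  shows "amult (LPA cj G) (lpa_class G x) (lpa_class G y) = lpa_class G (x * y)"
proof -
  have "lpa_class G (a * b) = lpa_class G (x * y)"
    if "a \<in> lpa_class G x" "b \<in> lpa_class G y" for a b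
  proof -
    have "(x - a) * y + a * (y - b) \<in> lpa_ideal G"
      using that assms lpa_ideal.mult_right[of "x - a" G y] lpa_ideal.mult_left[of "y - b" G a]
      by (intro lpa_ideal.add) (simp_all add: lpa_class_def)
    then have "x * y - a * b \<in> lpa_ideal G" by (simp add: algebra_simps)
    then show ?thesis by (rule lpa_class_cong[symmetric])
  qed
  then show ?thesis
    unfolding LPA_def star_algebra.simps
    by (rule UN2_const[OF lpa_class_self[OF assms(1)] lpa_class_self[OF assms(2)]])
qed

lemma LPA_scale:
  assumes "x \<in> free_carrier G"
  shows "ascale (LPA cj G) c (lpa_class G x) = lpa_class G (fscale c x)"
proof -
  have "lpa_class G (fscale c a) = lpa_class G (fscale c x)" if "a \<in> lpa_class G x" for a
  proof -
    have "fscale c (x - a) \<in> lpa_ideal G"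
      using that by (auto simp: lpa_class_def intro: lpa_ideal.scale)
    then show ?thesis by (intro lpa_class_cong[symmetric]) (simp add: fscale_diff)
  qed
  then show ?thesis
    unfolding LPA_def star_algebra.simps
    by (rule UN_const[OF lpa_class_self[OF assms]])
qed

lemma gen_star_gen_star: "gen_star (gen_star g) = g"
  by (cases g) auto

lemma word_star_word_star: "word_star (word_star w) = w"
  by (cases w) (simp add: word_star_def rev_map o_def gen_star_gen_star)

lemma word_star_add: "word_star (u + w) = word_star w + word_star u"
  by (simp add: word_star_def plus_gword_def)

lemma lookup_sum_pm:
  "Poly_Mapping.lookup (\<Sum>i\<in>I. f i) k = (\<Sum>i\<in>I. Poly_Mapping.lookup (f i) k)"
  by (induction I rule: infinite_finite_induct) (auto simp: lookup_add)

context
  fixes cj :: "'k::field \<Rightarrow> 'k"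
  assumes cj: "field_involution cj"
begin

lemma cj_0: "cj 0 = 0"
proof -
  have "cj 0 + cj 0 = cj 0 + 0" using cj by (metis add.right_neutral field_involution_def)
  then show ?thesis by (rule add_left_imp_eq)
qed

lemma lookup_free_star:
  "Poly_Mapping.lookup (free_star cj x) w = cj (Poly_Mapping.lookup x (word_star w))"
proof -
  have "Poly_Mapping.lookup (free_star cj x) w =
      (\<Sum>u\<in>Poly_Mapping.keys x. if u = word_star w then cj (Poly_Mapping.lookup x u) else 0)"
    unfolding free_star_def lookup_sum_pm
    by (intro sum.cong) (auto simp: lookup_single when_def word_star_word_star)
  also have "\<dots> = cj (Poly_Mapping.lookup x (word_star w))"
    by (auto simp: sum.delta in_keys_iff cj_0)
  finally show ?thesis .
qed

lemma free_star_add: "free_star cj (x + y) = free_star cj x + free_star cj y"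
  by (rule poly_mapping_eqI)
     (use cj in \<open>simp add: lookup_free_star lookup_add field_involution_def\<close>)

lemma free_star_0: "free_star cj 0 = 0"
  by (simp add: free_star_def)

lemma free_star_uminus: "free_star cj (- x) = - free_star cj x"
  using free_star_add[of x "- x"] by (metis add.right_inverse free_star_0 minus_unique)

lemma free_star_diff: "free_star cj (x - y) = free_star cj x - free_star cj y"
  using free_star_add[of x "- y"] by (simp add: free_star_uminus)

lemma free_star_sum: "free_star cj (\<Sum>i\<in>I. f i) = (\<Sum>i\<in>I. free_star cj (f i))"
  by (induction I rule: infinite_finite_induct) (auto simp: free_star_add free_star_0)

lemma free_star_single:
  "free_star cj (Poly_Mapping.single w c) = Poly_Mapping.single (word_star w) (cj c)"
  by (rule poly_mapping_eqI)
     (auto simp: lookup_free_star lookup_single when_def cj_0 word_star_word_star)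

lemma free_star_mon: "free_star cj (mon xs) = mon (rev (map gen_star xs))"
  using cj by (simp add: free_star_single field_involution_def word_star_def)

lemma sum_singles: "x = (\<Sum>w\<in>Poly_Mapping.keys x. Poly_Mapping.single w (Poly_Mapping.lookup x w))"
  by (rule poly_mapping_eqI)
     (auto simp: lookup_sum_pm lookup_single when_def in_keys_iff sum.delta)

lemma free_star_mult: "free_star cj (x * y) = free_star cj y * free_star cj x"
proof -
  let ?sx = "\<lambda>w. Poly_Mapping.single w (Poly_Mapping.lookup x w)"
  let ?sy = "\<lambda>w. Poly_Mapping.single w (Poly_Mapping.lookup y w)"
  have "x * y = (\<Sum>u\<in>Poly_Mapping.keys x. ?sx u) * (\<Sum>w\<in>Poly_Mapping.keys y. ?sy w)"
    by (simp only: sum_singles[symmetric])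
  also have "\<dots> = (\<Sum>u\<in>Poly_Mapping.keys x. \<Sum>w\<in>Poly_Mapping.keys y. ?sx u * ?sy w)"
    by (simp add: sum_product)
  finally have "free_star cj (x * y) =
      (\<Sum>u\<in>Poly_Mapping.keys x. \<Sum>w\<in>Poly_Mapping.keys y. free_star cj (?sx u * ?sy w))"
    by (simp add: free_star_sum)
  also have "\<dots> = (\<Sum>u\<in>Poly_Mapping.keys x. \<Sum>w\<in>Poly_Mapping.keys y.
      free_star cj (?sy w) * free_star cj (?sx u))"
    using cj by (simp add: mult_single free_star_single word_star_add field_involution_def
        mult.commute)
  also have "\<dots> = (\<Sum>w\<in>Poly_Mapping.keys y. free_star cj (?sy w)) *
      (\<Sum>u\<in>Poly_Mapping.keys x. free_star cj (?sx u))"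
    by (subst sum.swap) (simp add: sum_product)
  also have "\<dots> = free_star cj y * free_star cj x"
    by (simp only: free_star_sum[symmetric] sum_singles[symmetric])
  finally show ?thesis .
qed

lemma free_star_scale: "free_star cj (fscale c x) = fscale (cj c) (free_star cj x)"
proof (rule poly_mapping_eqI)
  have *: "Poly_Mapping.lookup (fscale d z) w = d * Poly_Mapping.lookup z w"
    for d and z :: "('a, 'b, 'k) free_alg" and w
  proof -
    have "fscale d z = (\<Sum>u\<in>Poly_Mapping.keys z. Poly_Mapping.single u (d * Poly_Mapping.lookup z u))"
      by (subst sum_singles[of z]) (simp add: fscale_def sum_distrib_left mult_single)
    then show ?thesis
      by (auto simp: lookup_sum_pm lookup_single when_def in_keys_iff sum.delta)
  qed
  show "Poly_Mapping.lookup (free_star cj (fscale c x)) w =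
      Poly_Mapping.lookup (fscale (cj c) (free_star cj x)) w" for w
    using cj by (simp add: lookup_free_star * field_involution_def)
qed

lemma free_carrier_star: "x \<in> free_carrier G \<Longrightarrow> free_star cj x \<in> free_carrier G"
proof -
  assume x: "x \<in> free_carrier G"
  have g: "gen_star g \<in> gens G" if "g \<in> gens G" for g
    using that by (auto simp: gens_def)
  have "letters w \<noteq> [] \<and> set (letters w) \<subseteq> gens G"
    if "w \<in> Poly_Mapping.keys (free_star cj x)" for w
  proof -
    have "word_star w \<in> Poly_Mapping.keys x"
      using that by (auto simp: in_keys_iff lookup_free_star cj_0)
    then have "letters (word_star w) \<noteq> []" "set (letters (word_star w)) \<subseteq> gens G"
      using x by (auto simp: free_carrier_def)
    then show ?thesis using g by (auto simp: word_star_def) (metis gen_star_gen_star image_subset_iff)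
  qed
  then show ?thesis by (auto simp: free_carrier_def)
qed

lemma relators_star: "x \<in> relators G \<Longrightarrow> free_star cj x \<in> relators G"
proof (induction rule: relators.induct)
  case (vertices v w)
  then show ?case using relators.vertices[of w G v]
    by (auto simp: free_star_diff free_star_mon free_star_0)
next
  case (CK1 e f)
  then show ?case using relators.CK1[of f G e]
    by (auto simp: free_star_diff free_star_mon free_star_0)
next
  case (CK2 v)
  then show ?case using relators.CK2[of v G]
    by (simp add: free_star_diff free_star_mon free_star_sum)
qed (auto simp: free_star_diff free_star_mon intro: relators.intros)

lemma ideal_star: "x \<in> lpa_ideal G \<Longrightarrow> free_star cj x \<in> lpa_ideal G"
proof (induction rule: lpa_ideal.induct)
  case (rel x)
  then show ?case by (rule lpa_ideal.rel[OF relators_star])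
next
  case zero
  show ?case by (simp only: free_star_0 lpa_ideal.zero)
next
  case (add x y)
  show ?case unfolding free_star_add by (rule lpa_ideal.add) fact+
next
  case (scale x c)
  show ?case unfolding free_star_scale by (rule lpa_ideal.scale) fact
next
  case (mult_left x f)
  show ?case unfolding free_star_mult
    by (rule lpa_ideal.mult_right) (fact, rule free_carrier_star, fact)
next
  case (mult_right x f)
  show ?case unfolding free_star_mult
    by (rule lpa_ideal.mult_left) (fact, rule free_carrier_star, fact)
qed

lemma LPA_star:
  assumes "x \<in> free_carrier G"
  shows "astar (LPA cj G) (lpa_class G x) = lpa_class G (free_star cj x)"
proof -
  have "lpa_class G (free_star cj a) = lpa_class G (free_star cj x)" if "a \<in> lpa_class G x" for a
  proof -
    have "free_star cj (x - a) \<in> lpa_ideal G"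
      using that by (auto simp: lpa_class_def intro: ideal_star)
    then show ?thesis by (intro lpa_class_cong[symmetric]) (simp add: free_star_diff)
  qed
  then show ?thesis
    unfolding LPA_def star_algebra.simps
    by (rule UN_const[OF lpa_class_self[OF assms]])
qed

lemma LPA_star_path_product:
  assumes "\<alpha> \<in> paths G" "\<beta> \<in> paths G"
  shows "astar (LPA cj G) (ascale (LPA cj G) c (path_product cj G \<alpha> \<beta>)) =
    ascale (LPA cj G) (cj c) (path_product cj G \<beta> \<alpha>)"
proof -
  have star: "rev (map gen_star (path_word \<gamma>)) = ghost_word \<gamma>"
       "rev (map gen_star (ghost_word \<gamma>)) = path_word \<gamma>" for \<gamma> :: "('a, 'b) path"
    by (cases \<gamma>; simp add: rev_map o_def)+
  have car: "mon (path_word \<gamma>) \<in> free_carrier G" "mon (ghost_word \<gamma>) \<in> free_carrier G"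
    if "\<gamma> \<in> paths G" for \<gamma>
    using that by (auto simp: paths_def free_carrier_def gens_def subset_iff)
  have pp: "path_product cj G \<gamma> \<delta> = lpa_class G (mon (path_word \<gamma>) * mon (ghost_word \<delta>))"
    if "\<gamma> \<in> paths G" "\<delta> \<in> paths G" for \<gamma> \<delta>
    using that by (simp add: path_product_def LPA_mult car)
  show ?thesis
    using assms by (simp add: pp LPA_scale LPA_star car free_carrier_mult free_carrier_scale
        free_star_scale free_star_mult free_star_mon star del: mult_single)
qed

end

end

theory Submission
  imports Defs
begin

text \<open>
  Only finitely many edges and vertices and only paths of bounded length occur in an element \<open>a\<close>
  of the core. Fix a finite set \<open>F\<close> of edges, a finite set \<open>V\<close> of vertices and a bound \<open>n\<close>, and
  let \<open>B\<close> be the span of all \<open>\<alpha>\<beta>\<^sup>*\<close> with \<open>|\<alpha>| = |\<beta>| \<le> n\<close> whose edges lie in \<open>F\<close> and whose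
  common source lies in \<open>V\<close>. There are finitely many such pairs, so \<open>B\<close> is finite-dimensional,
  and it is closed under the involution because the description is symmetric in \<open>\<alpha>\<close> and \<open>\<beta>\<close>.
  It is closed under products because \<open>\<alpha>\<beta>\<^sup>* \<gamma>\<delta>\<^sup>*\<close> is nonzero only if one of \<open>\<beta>\<close>, \<open>\<gamma>\<close> extends
  the other: if \<open>\<gamma> = \<beta>\<gamma>'\<close>, then the product is \<open>(\<alpha>\<gamma>')\<delta>\<^sup>*\<close>, where \<open>|\<alpha>\<gamma>'| = |\<gamma>| \<le> n\<close> and no new
  edge or vertex has appeared; the case \<open>\<beta> = \<gamma>\<beta>'\<close> is the mirror image. The equality
  \<open>|\<alpha>| = |\<beta>|\<close> is what keeps the lengths bounded. This is \<open>core_word_mult\<close>, which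
  rests on the cancellation lemma \<open>word_class_ghost_edge\<close>.

  The computation takes place in words \<open>x\<^sub>1\<dots>x\<^sub>k v y\<^sub>k\<^sup>*\<dots>y\<^sub>1\<^sup>*\<close> with the source \<open>v\<close> written in the
  middle, which treats vertices and paths of positive length alike. The edges of such a word need
  not fit together; a word in which two neighbours do not fit is zero in the Leavitt path
  algebra, so these words still span the core, and composability need not be tracked through
  products.
\<close>

section \<open>Spans and subalgebras\<close>

lemma aspan_least: "M \<subseteq> aspan A S \<Longrightarrow> aspan A M \<subseteq> aspan A S"
proof
  fix x assume M: "M \<subseteq> aspan A S" and "x \<in> aspan A M"
  from this(2) show "x \<in> aspan A S"
    by induction (use M in \<open>auto intro: aspan.intros\<close>)
qed

lemma aspan_mono: "M \<subseteq> N \<Longrightarrow> aspan A M \<subseteq> aspan A N"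
  by (rule aspan_least) (auto intro: aspan.base)

lemma fscale_mult_left: "fscale c x * y = fscale c (x * y)"
  by (simp add: fscale_def mult.assoc)

lemma fscale_mult_right:
  fixes x y :: "('v, 'e, 'k::field) free_alg"
  shows "x * fscale c y = fscale c (x * y)"
proof -
  have "field_involution (\<lambda>c. c :: 'k)"
    by (simp add: field_involution_def)
  note expand = sum_singles[OF this, of x]
  have "x * Poly_Mapping.single 0 c = Poly_Mapping.single 0 c * x"
    by (subst (1 2) expand)
       (simp add: sum_distrib_left sum_distrib_right mult_single mult.commute)
  then show ?thesis
    by (metis fscale_def mult.assoc)
qed

context
  fixes cj :: "'k::field \<Rightarrow> 'k" and G :: "('v, 'e) pre_digraph"
  assumes cj: "field_involution cj"
begin

lemma azero_LPA: "azero (LPA cj G) = lpa_class G 0"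
  by (simp add: LPA_def)

lemma space_LPA: "space (LPA cj G) = lpa_class G ` free_carrier G"
  by (simp add: LPA_def)

lemmas LPA_class_simps = azero_LPA space_LPA LPA_add LPA_mult LPA_scale LPA_star[OF cj]
  free_carrier_0 free_carrier_add free_carrier_mult free_carrier_scale free_carrier_star[OF cj]

lemma aspan_subset_space:
  assumes "M \<subseteq> space (LPA cj G)"
  shows "aspan (LPA cj G) M \<subseteq> space (LPA cj G)"
proof
  fix x assume "x \<in> aspan (LPA cj G) M"
  then show "x \<in> space (LPA cj G)"
    by induction (use assms in \<open>auto simp: LPA_class_simps\<close>)
qed

lemma amult_linear_left:
  assumes "z \<in> space (LPA cj G)"
  shows "amult (LPA cj G) (azero (LPA cj G)) z = azero (LPA cj G)"
    and "x \<in> space (LPA cj G) \<Longrightarrow> y \<in> space (LPA cj G) \<Longrightarrow>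
      amult (LPA cj G) (aadd (LPA cj G) x y) z
        = aadd (LPA cj G) (amult (LPA cj G) x z) (amult (LPA cj G) y z)"
    and "x \<in> space (LPA cj G) \<Longrightarrow>
      amult (LPA cj G) (ascale (LPA cj G) c x) z = ascale (LPA cj G) c (amult (LPA cj G) x z)"
  using assms by (auto simp: LPA_class_simps distrib_right fscale_mult_left)

lemma amult_linear_right:
  assumes "z \<in> space (LPA cj G)"
  shows "amult (LPA cj G) z (azero (LPA cj G)) = azero (LPA cj G)"
    and "x \<in> space (LPA cj G) \<Longrightarrow> y \<in> space (LPA cj G) \<Longrightarrow>
      amult (LPA cj G) z (aadd (LPA cj G) x y)
        = aadd (LPA cj G) (amult (LPA cj G) z x) (amult (LPA cj G) z y)"
    and "x \<in> space (LPA cj G) \<Longrightarrow>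
      amult (LPA cj G) z (ascale (LPA cj G) c x) = ascale (LPA cj G) c (amult (LPA cj G) z x)"
  using assms by (auto simp: LPA_class_simps distrib_left fscale_mult_right)

lemma astar_conjugate_linear:
  shows "astar (LPA cj G) (azero (LPA cj G)) = azero (LPA cj G)"
    and "x \<in> space (LPA cj G) \<Longrightarrow> y \<in> space (LPA cj G) \<Longrightarrow>
      astar (LPA cj G) (aadd (LPA cj G) x y)
        = aadd (LPA cj G) (astar (LPA cj G) x) (astar (LPA cj G) y)"
    and "x \<in> space (LPA cj G) \<Longrightarrow>
      astar (LPA cj G) (ascale (LPA cj G) c x) = ascale (LPA cj G) (cj c) (astar (LPA cj G) x)"
  by (auto simp: LPA_class_simps free_star_0[OF cj] free_star_add[OF cj] free_star_scale[OF cj])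

text \<open>
  The product is bilinear and the involution is conjugate-linear, so both closure conditions can
  be tested on a spanning set.
\<close>

lemma star_subalgebra_aspan:
  assumes M: "M \<subseteq> space (LPA cj G)"
    and mult: "\<And>x y. x \<in> M \<Longrightarrow> y \<in> M \<Longrightarrow> amult (LPA cj G) x y \<in> aspan (LPA cj G) M"
    and star: "\<And>x. x \<in> M \<Longrightarrow> astar (LPA cj G) x \<in> aspan (LPA cj G) M"
  shows "star_subalgebra (LPA cj G) (aspan (LPA cj G) M)"
proof -
  note sp = aspan_subset_space[OF M]
  have mult_gen: "amult (LPA cj G) x y \<in> aspan (LPA cj G) M"
    if "x \<in> aspan (LPA cj G) M" "y \<in> M" for x y
    using that(1)
  proof induction
    case zero
    then show ?case using that(2) M by (simp add: amult_linear_left subset_iff aspan.zero)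
  next
    case (base x)
    then show ?case using that(2) by (rule mult)
  next
    case (add x x')
    then show ?case
      using that(2) M sp by (simp add: amult_linear_left subset_iff aspan.add)
  next
    case (scale x c)
    then show ?case
      using that(2) M sp by (simp add: amult_linear_left subset_iff aspan.scale)
  qed
  have "amult (LPA cj G) x y \<in> aspan (LPA cj G) M"
    if "y \<in> aspan (LPA cj G) M" "x \<in> aspan (LPA cj G) M" for x y
    using that(1)
  proof induction
    case zero
    then show ?case using that(2) sp by (simp add: amult_linear_right subset_iff aspan.zero)
  next
    case (base y)
    then show ?case by (rule mult_gen[OF that(2)])
  next
    case (add y y')
    then show ?case
      using that(2) sp by (simp add: amult_linear_right subset_iff aspan.add)
  next
    case (scale y c)
    then show ?case
      using that(2) sp by (simp add: amult_linear_right subset_iff aspan.scale)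
  qed
  moreover have "astar (LPA cj G) x \<in> aspan (LPA cj G) M" if "x \<in> aspan (LPA cj G) M" for x
    using that
  proof induction
    case zero
    then show ?case by (simp add: astar_conjugate_linear aspan.zero)
  next
    case (base x)
    then show ?case by (rule star)
  next
    case (add x x')
    then show ?case
      using sp by (simp add: astar_conjugate_linear subset_iff aspan.add)
  next
    case (scale x c)
    then show ?case
      using sp by (simp add: astar_conjugate_linear subset_iff aspan.scale)
  qed
  ultimately show ?thesis
    using sp by (auto simp: star_subalgebra_def intro: aspan.intros)
qed

end


section \<open>Rewriting words in the Leavitt path algebra\<close>

abbreviation word_class ::
  "('v, 'e) pre_digraph \<Rightarrow> ('v, 'e) gen list \<Rightarrow> ('v, 'e, 'k::field) free_alg set" where
  "word_class G u \<equiv> lpa_class G (mon u)"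

lemma mon_append: "mon (u @ w) = mon u * mon w"
  by (simp add: mult_single plus_gword_def)

lemma mon_in_free_carrier: "u \<noteq> [] \<Longrightarrow> set u \<subseteq> gens G \<Longrightarrow> mon u \<in> free_carrier G"
  by (simp add: free_carrier_def)

text \<open>
  The ideal is closed only under multiplication by the non-unital free algebra, so an empty
  word on either side is a separate case.
\<close>

lemma ideal_mon_context:
  assumes x: "x \<in> lpa_ideal G" and p: "set p \<subseteq> gens G" and q: "set q \<subseteq> gens G"
  shows "mon p * x * mon q \<in> lpa_ideal G"
proof -
  have one: "mon [] = (1 :: ('v, 'e, 'k::field) free_alg)"
    by (simp add: zero_gword_def[symmetric])
  have "mon p * x \<in> lpa_ideal G"
    by (cases "p = []")
       (use x p in \<open>auto simp: one intro!: lpa_ideal.mult_left mon_in_free_carrier\<close>)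
  then show ?thesis
    by (cases "q = []")
       (use q in \<open>auto simp: one intro!: lpa_ideal.mult_right mon_in_free_carrier\<close>)
qed

lemma word_class_rewrite:
  fixes x :: "('v, 'e, 'k::field) free_alg"
  assumes "mon u - x \<in> lpa_ideal G" "set p \<subseteq> gens G" "set q \<subseteq> gens G"
  shows "word_class G (p @ u @ q) = lpa_class G (mon p * x * mon q)"
  using ideal_mon_context[OF assms]
  by (intro lpa_class_cong) (simp only: mon_append algebra_simps)

lemma word_class_rewrite_word:
  assumes "mon u - (mon w :: ('v, 'e, 'k::field) free_alg) \<in> lpa_ideal G"
    and "set p \<subseteq> gens G" "set q \<subseteq> gens G"
  shows "(word_class G (p @ u @ q) :: ('v, 'e, 'k) free_alg set) = word_class G (p @ w @ q)"
  using word_class_rewrite[OF assms] by (simp only: mon_append mult.assoc)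

lemma word_class_rewrite_0:
  assumes "(mon u :: ('v, 'e, 'k::field) free_alg) \<in> lpa_ideal G"
    and "set p \<subseteq> gens G" "set q \<subseteq> gens G"
  shows "(word_class G (p @ u @ q) :: ('v, 'e, 'k) free_alg set) = lpa_class G 0"
  using word_class_rewrite[of u 0 G p q] assms by simp

text \<open>
  Each generator \<open>g\<close> satisfies \<open>v g = g = g w\<close> for suitable vertices \<open>v\<close> and \<open>w\<close>.
  Naming them treats vertices, edges and ghost edges uniformly.
\<close>

fun left_vertex :: "('v, 'e) pre_digraph \<Rightarrow> ('v, 'e) gen \<Rightarrow> 'v" where
  "left_vertex G (Vtx v) = v"
| "left_vertex G (Edge e) = head G e"
| "left_vertex G (Ghost e) = tail G e"

fun right_vertex :: "('v, 'e) pre_digraph \<Rightarrow> ('v, 'e) gen \<Rightarrow> 'v" where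
  "right_vertex G (Vtx v) = v"
| "right_vertex G (Edge e) = tail G e"
| "right_vertex G (Ghost e) = head G e"

lemma Edge_in_gens: "Edge e \<in> gens G \<longleftrightarrow> e \<in> arcs G"
  and Ghost_in_gens: "Ghost e \<in> gens G \<longleftrightarrow> e \<in> arcs G"
  and Vtx_in_gens: "Vtx v \<in> gens G \<longleftrightarrow> v \<in> verts G"
  by (auto simp: gens_def)

lemmas in_gens = Edge_in_gens Ghost_in_gens Vtx_in_gens

lemma Edges_in_gens: "Edge ` F \<subseteq> gens G \<longleftrightarrow> F \<subseteq> arcs G"
  and Ghosts_in_gens: "Ghost ` F \<subseteq> gens G \<longleftrightarrow> F \<subseteq> arcs G"
  by (auto simp: in_gens)

section \<open>Spanning words of the core\<close>

definition core_word :: "'e list \<Rightarrow> 'v \<Rightarrow> 'e list \<Rightarrow> ('v, 'e) gen list" where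
  "core_word xs v ys = map Edge xs @ Vtx v # rev (map Ghost ys)"

definition core_words :: "'e set \<Rightarrow> 'v set \<Rightarrow> nat \<Rightarrow> ('v, 'e) gen list set" where
  "core_words F V n = {core_word xs v ys | xs v ys.
     set xs \<subseteq> F \<and> set ys \<subseteq> F \<and> v \<in> V \<and> length xs = length ys \<and> length ys \<le> n}"

lemma core_wordsI:
  "set xs \<subseteq> F \<Longrightarrow> set ys \<subseteq> F \<Longrightarrow> v \<in> V \<Longrightarrow> length xs = length ys \<Longrightarrow> length ys \<le> n \<Longrightarrow>
    core_word xs v ys \<in> core_words F V n"
  unfolding core_words_def by blast

lemma core_words_mono: "F \<subseteq> F' \<Longrightarrow> V \<subseteq> V' \<Longrightarrow> n \<le> n' \<Longrightarrow> core_words F V n \<subseteq> core_words F' V' n'"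
  unfolding core_words_def by fastforce

lemma finite_core_words:
  assumes "finite F" "finite V"
  shows "finite (core_words F V n)"
proof -
  let ?L = "{xs. set xs \<subseteq> F \<and> length xs \<le> n}"
  have "core_words F V n \<subseteq> (\<lambda>(xs, v, ys). core_word xs v ys) ` (?L \<times> V \<times> ?L)"
    by (auto simp: core_words_def intro!: image_eqI[where x = "(_, _, _)"])
  moreover have "finite (?L \<times> V \<times> ?L)"
    using assms by (auto intro: finite_lists_length_le)
  ultimately show ?thesis
    by (meson finite_imageI finite_subset)
qed

lemma core_words_in_free_carrier:
  assumes "F \<subseteq> arcs G" "V \<subseteq> verts G" "u \<in> core_words F V n"
  shows "(mon u :: ('v, 'e, 'k::field) free_alg) \<in> free_carrier G"
  using assms
  by (intro mon_in_free_carrier) (auto simp: core_words_def core_word_def in_gens subset_iff)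


section \<open>Cancellation in words\<close>

context
  fixes G :: "('v, 'e) pre_digraph"
  assumes wf: "wf_digraph G"
begin

lemma end_vertices_in_verts:
  assumes "g \<in> gens G"
  shows "left_vertex G g \<in> verts G" "right_vertex G g \<in> verts G"
  using assms wf by (cases g; auto simp: in_gens wf_digraph_def)+

lemma word_class_left_vertex:
  assumes "g \<in> gens G" "set p \<subseteq> gens G" "set q \<subseteq> gens G"
  shows "(word_class G (p @ Vtx (left_vertex G g) # g # q) :: ('v, 'e, 'k::field) free_alg set)
    = word_class G (p @ g # q)"
proof -
  have "mon [Vtx (left_vertex G g), g] - mon [g] \<in> relators G"
  proof (cases g)
    case (Vtx v)
    then show ?thesis using assms relators.vertices[of v G v] by (simp add: in_gens)
  qed (use assms in \<open>auto simp: in_gens intro: relators.intros\<close>)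
  from word_class_rewrite_word[OF lpa_ideal.rel[OF this] assms(2,3)] show ?thesis by simp
qed

lemma word_class_right_vertex:
  assumes "g \<in> gens G" "set p \<subseteq> gens G" "set q \<subseteq> gens G"
  shows "(word_class G (p @ g # Vtx (right_vertex G g) # q) :: ('v, 'e, 'k::field) free_alg set)
    = word_class G (p @ g # q)"
proof -
  have "mon [g, Vtx (right_vertex G g)] - mon [g] \<in> relators G"
  proof (cases g)
    case (Vtx v)
    then show ?thesis using assms relators.vertices[of v G v] by (simp add: in_gens)
  qed (use assms in \<open>auto simp: in_gens intro: relators.intros\<close>)
  from word_class_rewrite_word[OF lpa_ideal.rel[OF this] assms(2,3)] show ?thesis by simp
qed

text \<open>
  If \<open>g = g v\<close> and \<open>h = w h\<close> with distinct vertices \<open>v\<close> and \<open>w\<close>, then \<open>g h = g (v w) h = 0\<close>.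
\<close>

lemma word_class_mismatch:
  assumes g: "g \<in> gens G" and h: "h \<in> gens G" and p: "set p \<subseteq> gens G" and q: "set q \<subseteq> gens G"
    and ne: "right_vertex G g \<noteq> left_vertex G h"
  shows "word_class G (p @ g # h # q) = (lpa_class G 0 :: ('v, 'e, 'k::field) free_alg set)"
proof -
  let ?v = "right_vertex G g" and ?w = "left_vertex G h"
  have v: "?v \<in> verts G" and w: "?w \<in> verts G"
    using end_vertices_in_verts g h by blast+
  have "(mon [Vtx ?v, Vtx ?w] :: ('v, 'e, 'k) free_alg) \<in> lpa_ideal G"
    using relators.vertices[OF v w] ne by (auto intro: lpa_ideal.rel)
  from word_class_rewrite_0[OF this, of "p @ [g]" "h # q"]
  have "word_class G (p @ g # Vtx ?v # Vtx ?w # h # q)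
      = (lpa_class G 0 :: ('v, 'e, 'k) free_alg set)"
    using assms by simp
  moreover have "word_class G (p @ g # Vtx ?v # Vtx ?w # h # q)
      = (word_class G (p @ g # Vtx ?w # h # q) :: ('v, 'e, 'k) free_alg set)"
    using word_class_right_vertex[of g p "Vtx ?w # h # q"] assms w by (simp add: in_gens)
  moreover have "word_class G (p @ g # Vtx ?w # h # q)
      = (word_class G (p @ g # h # q) :: ('v, 'e, 'k) free_alg set)"
    using word_class_left_vertex[of h "p @ [g]" q] assms by simp
  ultimately show ?thesis by simp
qed

lemma word_class_nonzero_successively:
  assumes u: "set u \<subseteq> gens G"
    and nz: "word_class G u \<noteq> (lpa_class G 0 :: ('v, 'e, 'k::field) free_alg set)"
  shows "successively (\<lambda>g h. right_vertex G g = left_vertex G h) u"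
proof (unfold successively_conv_nth, intro allI impI)
  fix i assume i: "Suc i < length u"
  have dec: "u = take i u @ u ! i # u ! Suc i # drop (Suc (Suc i)) u"
    using i by (metis Cons_nth_drop_Suc Suc_lessD append_take_drop_id)
  have "set (take i u) \<subseteq> gens G" "set (drop (Suc (Suc i)) u) \<subseteq> gens G"
    "u ! i \<in> gens G" "u ! Suc i \<in> gens G"
    using u i set_take_subset[of i u] set_drop_subset[of "Suc (Suc i)" u] by (auto simp: subset_iff)
  with nz dec show "right_vertex G (u ! i) = left_vertex G (u ! Suc i)"
    using word_class_mismatch by metis
qed

lemma word_class_absorb_left:
  assumes "g \<in> gens G" "v \<in> verts G" "set p \<subseteq> gens G" "set q \<subseteq> gens G"
  shows "word_class G (p @ Vtx v # g # q) = (lpa_class G 0 :: ('v, 'e, 'k::field) free_alg set) \<or>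
    word_class G (p @ Vtx v # g # q) = (word_class G (p @ g # q) :: ('v, 'e, 'k) free_alg set)"
  using word_class_mismatch[of "Vtx v" g p q] word_class_left_vertex[of g p q] assms
  by (cases "v = left_vertex G g") (auto simp: in_gens)

lemma word_class_absorb_right:
  assumes "g \<in> gens G" "v \<in> verts G" "set p \<subseteq> gens G" "set q \<subseteq> gens G"
  shows "word_class G (p @ g # Vtx v # q) = (lpa_class G 0 :: ('v, 'e, 'k::field) free_alg set) \<or>
    word_class G (p @ g # Vtx v # q) = (word_class G (p @ g # q) :: ('v, 'e, 'k) free_alg set)"
  using word_class_mismatch[of g "Vtx v" p q] word_class_right_vertex[of g p q] assms
  by (cases "v = right_vertex G g") (auto simp: in_gens)

text \<open>
  The word \<open>v y\<^sub>m\<^sup>*\<dots>y\<^sub>1\<^sup>* z\<^sub>1\<dots>z\<^sub>k w\<close> is shortened from the middle. If \<open>y\<^sub>1 \<noteq> z\<^sub>1\<close> it vanishes;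
  otherwise \<open>y\<^sub>1\<^sup>* z\<^sub>1\<close> is a vertex, which the next letter absorbs or annihilates. If this never
  produces zero, one of the two lists is used up and is a prefix of the other.
\<close>

lemma word_class_ghost_edge:
  assumes "set ys \<subseteq> arcs G" "set zs \<subseteq> arcs G" "v \<in> verts G" "w \<in> verts G"
    and p: "set p \<subseteq> gens G" and q: "set q \<subseteq> gens G"
  defines "C \<equiv> word_class G (p @ Vtx v # rev (map Ghost ys) @ map Edge zs @ Vtx w # q)
      :: ('v, 'e, 'k::field) free_alg set"
  shows "C = lpa_class G 0 \<or>
    (\<exists>zs'. zs = ys @ zs' \<and> C = word_class G (p @ map Edge zs' @ Vtx w # q)) \<or>
    (\<exists>ys'. ys = zs @ ys' \<and> C = word_class G (p @ Vtx v # rev (map Ghost ys') @ q))"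
  using assms(1-4) unfolding C_def
proof (induction ys zs rule: list_induct2')
  case 1
  then show ?case
    using word_class_absorb_left[of "Vtx w" v p q] p q by (auto simp: in_gens)
next
  case (2 y ys)
  let ?p = "p @ Vtx v # rev (map Ghost ys)"
  have "word_class G (?p @ Ghost y # Vtx w # q) = (lpa_class G 0 :: ('v, 'e, 'k) free_alg set) \<or>
      word_class G (?p @ Ghost y # Vtx w # q)
        = (word_class G (?p @ Ghost y # q) :: ('v, 'e, 'k) free_alg set)"
    using 2 p q by (intro word_class_absorb_right) (auto simp: in_gens)
  then show ?case by simp
next
  case (3 z zs)
  then have "word_class G (p @ Vtx v # Edge z # map Edge zs @ Vtx w # q)
        = (lpa_class G 0 :: ('v, 'e, 'k) free_alg set) \<or>
      word_class G (p @ Vtx v # Edge z # map Edge zs @ Vtx w # q)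
        = (word_class G (p @ Edge z # map Edge zs @ Vtx w # q) :: ('v, 'e, 'k) free_alg set)"
    using p q by (intro word_class_absorb_left) (auto simp: in_gens)
  then show ?case by simp
next
  case (4 y ys z zs)
  let ?p = "p @ Vtx v # rev (map Ghost ys)" and ?q = "map Edge zs @ Vtx w # q"
  have gens: "set ?p \<subseteq> gens G" "set ?q \<subseteq> gens G" and y: "y \<in> arcs G" and z: "z \<in> arcs G"
    using 4 p q by (auto simp: in_gens)
  have word: "p @ Vtx v # rev (map Ghost (y # ys)) @ map Edge (z # zs) @ Vtx w # q
      = ?p @ [Ghost y, Edge z] @ ?q" by simp
  show ?case
  proof (cases "y = z")
    case False
    then have "(mon [Ghost y, Edge z] :: ('v, 'e, 'k) free_alg) \<in> lpa_ideal G"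
      using relators.CK1[OF y z] by (auto intro: lpa_ideal.rel)
    from word_class_rewrite_0[OF this gens] show ?thesis unfolding word by (rule disjI1)
  next
    case True
    have "mon [Ghost y, Edge z] - (mon [Vtx (tail G y)] :: ('v, 'e, 'k) free_alg) \<in> lpa_ideal G"
      using relators.CK1[OF y z] True by (auto intro: lpa_ideal.rel)
    from word_class_rewrite_word[OF this gens]
    have eq: "(word_class G (?p @ [Ghost y, Edge z] @ ?q) :: ('v, 'e, 'k) free_alg set)
        = word_class G (?p @ Vtx (tail G y) # ?q)" by simp
    obtain g q' where gq: "?q = g # q'"
      by (cases ?q) auto
    have "tail G y \<in> verts G"
      using wf y by (simp add: wf_digraph_def)
    then have "word_class G (?p @ Vtx (tail G y) # ?q)
          = (lpa_class G 0 :: ('v, 'e, 'k) free_alg set) \<or>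
        word_class G (?p @ Vtx (tail G y) # ?q) = (word_class G (?p @ ?q) :: ('v, 'e, 'k) free_alg set)"
      using word_class_absorb_left[of g "tail G y" ?p q'] gens unfolding gq by simp
    then have red: "word_class G (?p @ [Ghost y, Edge z] @ ?q)
          = (lpa_class G 0 :: ('v, 'e, 'k) free_alg set) \<or>
        word_class G (?p @ [Ghost y, Edge z] @ ?q)
          = (word_class G (?p @ ?q) :: ('v, 'e, 'k) free_alg set)"
      by (simp only: eq)
    have "set ys \<subseteq> arcs G" "set zs \<subseteq> arcs G"
      using 4 by auto
    note IH = "4.IH"[OF this "4.prems"(3,4)]
    show ?thesis
    proof (cases "word_class G (?p @ [Ghost y, Edge z] @ ?q)
        = (lpa_class G 0 :: ('v, 'e, 'k) free_alg set)")
      case True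
      then show ?thesis unfolding word by (rule disjI1)
    next
      case False
      with red have shorter: "(word_class G (?p @ [Ghost y, Edge z] @ ?q) :: ('v, 'e, 'k) free_alg set)
          = word_class G (p @ Vtx v # rev (map Ghost ys) @ ?q)"
        by simp
      show ?thesis
        using IH unfolding word unfolding shorter unfolding \<open>y = z\<close>
        by (simp only: append_Cons list.inject simp_thms)
    qed
  qed
qed


section \<open>The subalgebras spanned by core words\<close>

lemma core_word_mult:
  assumes F: "F \<subseteq> arcs G" and V: "V \<subseteq> verts G"
    and u: "u \<in> core_words F V n" and u': "u' \<in> core_words F V n"
  shows "word_class G (u @ u') = (lpa_class G 0 :: ('v, 'e, 'k::field) free_alg set) \<or>
    (\<exists>t\<in>core_words F V n. word_class G (u @ u') = (word_class G t :: ('v, 'e, 'k) free_alg set))"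
proof -
  obtain xs v ys where u_eq: "u = core_word xs v ys"
    and xy: "set xs \<subseteq> F" "set ys \<subseteq> F" "v \<in> V" "length xs = length ys" "length ys \<le> n"
    using u by (auto simp: core_words_def)
  obtain zs w us where u'_eq: "u' = core_word zs w us"
    and zu: "set zs \<subseteq> F" "set us \<subseteq> F" "w \<in> V" "length zs = length us" "length us \<le> n"
    using u' by (auto simp: core_words_def)
  let ?p = "map Edge xs :: ('v, 'e) gen list" and ?q = "rev (map Ghost us) :: ('v, 'e) gen list"
  have word: "u @ u' = ?p @ Vtx v # rev (map Ghost ys) @ map Edge zs @ Vtx w # ?q"
    by (simp add: u_eq u'_eq core_word_def)
  have "set ?p \<subseteq> gens G" "set ?q \<subseteq> gens G"
    using F xy zu by (auto simp: in_gens)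
  moreover have "set ys \<subseteq> arcs G" "set zs \<subseteq> arcs G" "v \<in> verts G" "w \<in> verts G"
    using F V xy zu by auto
  ultimately consider
      (null) "word_class G (u @ u') = (lpa_class G 0 :: ('v, 'e, 'k) free_alg set)"
    | (left) zs' where "zs = ys @ zs'"
        "word_class G (u @ u')
          = (word_class G (core_word (xs @ zs') w us) :: ('v, 'e, 'k) free_alg set)"
    | (right) ys' where "ys = zs @ ys'"
        "word_class G (u @ u')
          = (word_class G (core_word xs v (us @ ys')) :: ('v, 'e, 'k) free_alg set)"
    using word_class_ghost_edge[of ys zs v w ?p ?q]
    unfolding word core_word_def by force
  then show ?thesis
  proof cases
    case left
    then have "core_word (xs @ zs') w us \<in> core_words F V n"
      using xy zu by (intro core_wordsI) auto
    with left show ?thesis by blast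
  next
    case right
    then have "core_word xs v (us @ ys') \<in> core_words F V n"
      using xy zu by (intro core_wordsI) auto
    with right show ?thesis by blast
  qed simp
qed

text \<open>
  For composable edges the vertex in the middle is absorbed by the last edge, which leaves
  the product \<open>\<alpha>\<beta>\<^sup>*\<close>.
\<close>

lemma path_product_EPath:
  assumes "EPath xs \<in> paths G" "EPath ys \<in> paths G"
  shows "path_product (cj :: 'k::field \<Rightarrow> 'k) G (EPath xs) (EPath ys)
    = word_class G (core_word xs (tail G (last xs)) ys)"
proof -
  have xs: "xs \<noteq> []" "set xs \<subseteq> arcs G" and ys: "ys \<noteq> []" "set ys \<subseteq> arcs G"
    using assms by (auto simp: paths_def)
  obtain es e where es: "xs = es @ [e]"
    using xs by (metis rev_exhaust)
  have "(word_class G (core_word xs (tail G (last xs)) ys) :: ('v, 'e, 'k) free_alg set)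
      = word_class G (map Edge xs @ rev (map Ghost ys))"
    using word_class_right_vertex[of "Edge e" "map Edge es" "rev (map Ghost ys)", where ?'k = 'k] xs ys
    by (simp add: core_word_def es Edge_in_gens Edges_in_gens Ghosts_in_gens)
  moreover have "path_product cj G (EPath xs) (EPath ys)
      = word_class G (map Edge xs @ rev (map Ghost ys))"
    using xs ys unfolding path_product_def mon_append
    by (simp add: LPA_mult mon_in_free_carrier Edges_in_gens Ghosts_in_gens del: mult_single)
  ultimately show ?thesis by simp
qed

lemma path_product_VPath:
  assumes "v \<in> verts G"
  shows "path_product cj G (VPath v) (VPath v) = word_class G (core_word [] v [])"
proof -
  have "path_product cj G (VPath v) (VPath v) = word_class G ([] @ Vtx v # Vtx v # [])"
    using assms LPA_mult[of "mon [Vtx v]" G "mon [Vtx v]" cj]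
    by (simp add: path_product_def mon_in_free_carrier in_gens mult_single plus_gword_def)
  then show ?thesis
    using word_class_left_vertex[of "Vtx v" "[]" "[]"] assms by (simp add: core_word_def in_gens)
qed

text \<open>
  If all neighbours in a core word fit, its two edge lists are paths with common source \<open>v\<close> and
  it represents their product; otherwise it represents zero.
\<close>

lemma core_words_in_core:
  assumes F: "F \<subseteq> arcs G" and V: "V \<subseteq> verts G" and u: "u \<in> core_words F V n"
  shows "word_class G u \<in> LPA_core (cj :: 'k::field \<Rightarrow> 'k) G"
proof (cases "word_class G u = (lpa_class G 0 :: ('v, 'e, 'k) free_alg set)")
  case True
  then show ?thesis
    using aspan.zero[of "LPA cj G"] by (simp add: LPA_core_def LPA_def)
next
  case nonzero: False
  obtain xs v ys where u_eq: "u = core_word xs v ys"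
    and xy: "set xs \<subseteq> arcs G" "set ys \<subseteq> arcs G" "v \<in> verts G" "length xs = length ys"
    using u F V by (auto simp: core_words_def)
  show ?thesis
  proof (cases "xs = []")
    case True
    then have "word_class G u = path_product cj G (VPath v) (VPath v)"
      using xy by (simp add: u_eq path_product_VPath)
    then show ?thesis
      using xy unfolding LPA_core_def by (force simp: paths_def intro!: aspan.base)
  next
    case False
    then have ne: "xs \<noteq> []" "ys \<noteq> []"
      using xy by auto
    have "set u \<subseteq> gens G"
      using xy by (auto simp: u_eq core_word_def in_gens)
    from word_class_nonzero_successively[OF this nonzero]
    have "successively (\<lambda>e f. tail G e = head G f) xs" "tail G (last xs) = v"
      "successively (\<lambda>e f. tail G e = head G f) ys" "tail G (last ys) = v"
      using ne
      by (auto simp: u_eq core_word_def successively_append_iff successively_Cons successively_map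
          successively_rev last_map hd_rev eq_commute simp flip: rev_map)
    then have p: "EPath xs \<in> paths G" "EPath ys \<in> paths G"
        "path_source G (EPath xs) = path_source G (EPath ys)"
        "path_length (EPath xs) = path_length (EPath ys)"
      and "word_class G u = path_product cj G (EPath xs) (EPath ys)"
      using ne xy path_product_EPath[of xs ys cj]
      by (auto simp: paths_def successively_conv_nth u_eq)
    then show ?thesis
      unfolding LPA_core_def by (intro aspan.base) blast
  qed
qed

text \<open>
  The spanning sets grow with the edges, the vertices and the length bound, so two elements of the
  core always lie in a common such span.
\<close>

lemma core_element_in_span_core_words:
  assumes "a \<in> LPA_core (cj :: 'k::field \<Rightarrow> 'k) G"
  shows "\<exists>F V n. finite F \<and> finite V \<and> F \<subseteq> arcs G \<and> V \<subseteq> verts G \<and>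
    a \<in> aspan (LPA cj G) (word_class G ` core_words F V n)"
  using assms unfolding LPA_core_def
proof induction
  case zero
  show ?case by (rule exI[of _ "{}"])+ (auto intro: aspan.zero)
next
  case (base x)
  then obtain \<alpha> \<beta> where x: "x = path_product cj G \<alpha> \<beta>" and \<alpha>: "\<alpha> \<in> paths G" and \<beta>: "\<beta> \<in> paths G"
    and s: "path_source G \<alpha> = path_source G \<beta>" and l: "path_length \<alpha> = path_length \<beta>"
    by blast
  have "\<exists>xs ys v. set xs \<subseteq> arcs G \<and> set ys \<subseteq> arcs G \<and> v \<in> verts G \<and> length xs = length ys \<and>
      x = word_class G (core_word xs v ys)"
  proof (cases \<alpha>)
    case (VPath v)
    moreover have "\<beta> = VPath v"
      using VPath s l \<beta> by (cases \<beta>) (auto simp: paths_def)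
    moreover have "v \<in> verts G"
      using \<alpha> VPath by (auto simp: paths_def)
    ultimately show ?thesis
      by (intro exI[of _ "[]"] exI[of _ v]) (simp add: x path_product_VPath)
  next
    case (EPath xs)
    then obtain ys where ys: "\<beta> = EPath ys"
      using l \<alpha> by (cases \<beta>) (auto simp: paths_def)
    have "xs \<noteq> []" and arcs: "set xs \<subseteq> arcs G" "set ys \<subseteq> arcs G"
      using \<alpha> \<beta> EPath ys by (auto simp: paths_def)
    then have "last xs \<in> arcs G"
      by auto
    then have "tail G (last xs) \<in> verts G"
      using wf by (simp add: wf_digraph_def)
    with arcs l show ?thesis
      using path_product_EPath[of xs ys cj] \<alpha> \<beta> EPath ys by (auto simp: x)
  qed
  then obtain xs ys v where *: "set xs \<subseteq> arcs G" "set ys \<subseteq> arcs G" "v \<in> verts G"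
      "length xs = length ys" and x: "x = word_class G (core_word xs v ys)"
    by blast
  have "core_word xs v ys \<in> core_words (set xs \<union> set ys) {v} (length ys)"
    using * by (auto simp: core_words_def)
  then have "x \<in> aspan (LPA cj G)
      (word_class G ` core_words (set xs \<union> set ys) {v} (length ys))"
    unfolding x by (intro aspan.base imageI)
  with * show ?case
    by (intro exI[of _ "set xs \<union> set ys"] exI[of _ "{v}"] exI[of _ "length ys"]) simp
next
  case (add x y)
  obtain F V n where x: "finite F" "finite V" "F \<subseteq> arcs G" "V \<subseteq> verts G"
      "x \<in> aspan (LPA cj G) (word_class G ` core_words F V n)"
    using add.IH(1) by blast
  obtain F' V' n' where y: "finite F'" "finite V'" "F' \<subseteq> arcs G" "V' \<subseteq> verts G"
      "y \<in> aspan (LPA cj G) (word_class G ` core_words F' V' n')"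
    using add.IH(2) by blast
  let ?S = "aspan (LPA cj G) (word_class G ` core_words (F \<union> F') (V \<union> V') (max n n'))"
  have "x \<in> ?S"
    by (rule subsetD[OF aspan_mono[OF image_mono[OF core_words_mono]] x(5)]) auto
  moreover have "y \<in> ?S"
    by (rule subsetD[OF aspan_mono[OF image_mono[OF core_words_mono]] y(5)]) auto
  ultimately have "aadd (LPA cj G) x y \<in> ?S"
    by (rule aspan.add)
  with x y show ?case
    by (intro exI[of _ "F \<union> F'"] exI[of _ "V \<union> V'"] exI[of _ "max n n'"]) simp
next
  case (scale x c)
  then show ?case by (blast intro: aspan.scale)
qed

lemma star_subalgebra_core_words:
  assumes cj: "field_involution (cj :: 'k::field \<Rightarrow> 'k)" and F: "F \<subseteq> arcs G" and V: "V \<subseteq> verts G"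
  shows "star_subalgebra (LPA cj G) (aspan (LPA cj G) (word_class G ` core_words F V n))"
proof (rule star_subalgebra_aspan[OF cj])
  show "word_class G ` core_words F V n \<subseteq> space (LPA cj G)"
    using core_words_in_free_carrier[OF F V] by (auto simp: LPA_def)
next
  fix x y :: "('v, 'e, 'k) free_alg set"
  assume "x \<in> word_class G ` core_words F V n" "y \<in> word_class G ` core_words F V n"
  then obtain u w where u: "u \<in> core_words F V n" "x = word_class G u"
    and w: "w \<in> core_words F V n" "y = word_class G w" by blast
  have "amult (LPA cj G) x y = word_class G (u @ w)"
    unfolding u(2) w(2) mon_append
    by (rule LPA_mult[OF core_words_in_free_carrier[OF F V u(1)] core_words_in_free_carrier[OF F V w(1)]])
  then show "amult (LPA cj G) x y \<in> aspan (LPA cj G) (word_class G ` core_words F V n)"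
    using core_word_mult[OF F V u(1) w(1), where ?'k = 'k]
    by (auto simp: azero_LPA[OF cj, symmetric] intro: aspan.zero aspan.base)
next
  fix x :: "('v, 'e, 'k) free_alg set"
  assume "x \<in> word_class G ` core_words F V n"
  then obtain xs v ys where *: "set xs \<subseteq> F" "set ys \<subseteq> F" "v \<in> V" "length xs = length ys"
      "length ys \<le> n"
    and x: "x = word_class G (core_word xs v ys)"
    by (auto simp: core_words_def)
  have "rev (map gen_star (core_word xs v ys)) = core_word ys v xs"
    by (simp add: core_word_def rev_map o_def)
  then have "astar (LPA cj G) x = word_class G (core_word ys v xs)"
    using core_words_in_free_carrier[OF F V core_wordsI[OF *], where ?'k = 'k]
    by (simp add: x LPA_star[OF cj] free_star_mon[OF cj])
  moreover have "core_word ys v xs \<in> core_words F V n"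
    using * by (intro core_wordsI) auto
  ultimately show "astar (LPA cj G) x \<in> aspan (LPA cj G) (word_class G ` core_words F V n)"
    by (auto intro: aspan.base)
qed

end

theorem proposition10:
  fixes G :: "('v, 'e) pre_digraph" and cj :: "'k::field \<Rightarrow> 'k"
    and a :: "('v, 'e, 'k) free_alg set"
  assumes "wf_digraph G"
    and "field_involution cj"
    and "a \<in> LPA_core cj G"
  shows "\<exists>B. star_subalgebra (LPA cj G) B \<and> B \<subseteq> LPA_core cj G \<and>
           finite_dimensional (LPA cj G) B \<and> a \<in> B"
proof -
  obtain F V n where fin: "finite F" "finite V" and F: "F \<subseteq> arcs G" and V: "V \<subseteq> verts G"
    and a: "a \<in> aspan (LPA cj G) (word_class G ` core_words F V n)"
    using core_element_in_span_core_words[OF assms(1,3)] by blast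
  let ?S = "word_class G ` core_words F V n"
  have "aspan (LPA cj G) ?S \<subseteq> LPA_core cj G"
    using core_words_in_core[OF assms(1) F V] unfolding LPA_core_def
    by (intro aspan_least) blast
  moreover have "finite_dimensional (LPA cj G) (aspan (LPA cj G) ?S)"
    unfolding finite_dimensional_def
    by (intro exI[of _ ?S]) (auto simp: finite_core_words fin intro: aspan.base)
  ultimately show ?thesis
    using star_subalgebra_core_words[OF assms(1,2) F V] a by blast
qed

end
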